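(* Suppose that the data set $\{(x_i,y_i): i\in\mathbb{N}_N\}$ (with derivative values $d_i$ at $x_i$) lies above the line $t=mx+k$, that is, $y_i>t_i$ for all $i\in\mathbb{N}_N$, where $t_i=mx_i+k$. Then the graph of the corresponding rational cubic spline fractal interpolation function $\Psi$ lies above the line $t=mx+k$, i.e. $\Psi(x)>mx+k$ for all $x\in I$, if for every $i\in\mathbb{N}_{N-1}$ the scaling factors $|\alpha_i|<a_i$ and the shape parameters $u_i>0$, $v_i>0$ further satisfy $$0\le\alpha_i<\min\Big\{\frac{y_i-t_i}{y_1-t_1},\frac{y_{i+1}-t_{i+1}}{y_N-t_N}\Big\},\qquad u_i>0,\qquad v_i>\max\{0,v_{9i},v_{10i}\},$$ where $$v_{9i}=-u_i\,\frac{2(y_i-t_i)+(y_i-t_{i+1})+h_id_i-\alpha_i\{2(y_1-t_1)+(y_1-t_N)+(x_N-x_1)d_1\}}{y_i-t_i-\alpha_i(y_1-t_1)},$$ $$v_{10i}=-u_i\,\frac{(y_{i+1}-t_i)+2(y_{i+1}-t_{i+1})-h_id_{i+1}-\alpha_i\{(y_N-t_1)+2(y_N-t_N)-(x_N-x_1)d_N\}}{y_{i+1}-t_{i+1}-\alpha_i(y_N-t_N)}.$$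
   Context: Notation: $\mathbb{N}_r=\{1,2,\dots,r\}$; $N>2$; $x_1<x_2<\dots<x_N$ are real knots, $I=[x_1,x_N]$, $I_i=[x_i,x_{i+1}]$, $h_i=x_{i+1}-x_i$; $m,k$ are real numbers. The real numbers $y_i$ and $d_i$ are, respectively, the prescribed function value and derivative value at the knot $x_i$. For $i\in\mathbb{N}_{N-1}$, $L_i:I\to I_i$ is the affine map $L_i(x)=a_ix+b_i$ with $L_i(x_1)=x_i$, $L_i(x_N)=x_{i+1}$, so $a_i=\frac{x_{i+1}-x_i}{x_N-x_1}$ and $b_i=\frac{x_Nx_i-x_1x_{i+1}}{x_N-x_1}$. Rational cubic spline fractal interpolation function (RCSFIF): given scaling factors $\alpha_i$ with $|\alpha_i|<a_i$ and shape parameters $u_i>0$, $v_i\ge 0$ ($i\in\mathbb{N}_{N-1}$), the RCSFIF $\Psi$ corresponding to the data $\{(x_i,y_i,d_i)\}$ is the unique continuous function $\Psi:I\to\mathbb{R}$ with $\Psi(x_1)=y_1$, $\Psi(x_N)=y_N$ satisfying, for all $x\in I$ and all $i\in\mathbb{N}_{N-1}$, $$\Psi(L_i(x))=\alpha_i\Psi(x)+\frac{P_i^*(\theta)}{Q_i^*(\theta)},\qquad \theta=\frac{x-x_1}{x_N-x_1},$$ where $Q_i^*(\theta)=u_i+v_i\theta(1-\theta)$ and $P_i^*(\theta)=U_i(1-\theta)^3+V_i(1-\theta)^2\theta+W_i(1-\theta)\theta^2+Z_i\theta^3$ with $$U_i=u_i(y_i-\alpha_iy_1),\qquad Z_i=u_i(y_{i+1}-\alpha_iy_N),$$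 $$V_i=(3u_i+v_i)(y_i-\alpha_iy_1)+u_ih_id_i-\alpha_iu_i(x_N-x_1)d_1,$$ $$W_i=(3u_i+v_i)(y_{i+1}-\alpha_iy_N)-u_ih_id_{i+1}+\alpha_iu_i(x_N-x_1)d_N.$$ *)

theory Defs
  imports "HOL-Analysis.Analysis"
begin

text \<open>
  A data set consists of a number \<open>N\<close> of knots and sequences \<open>x\<close>, \<open>y\<close>, \<open>d\<close> (knots, prescribed
  values and prescribed derivatives), of which only the entries with index in \<open>{1..N}\<close> are used.
  The scaling factors \<open>\<alpha>\<close> and the shape parameters \<open>u\<close>, \<open>v\<close> are used for indices in \<open>{1..N - 1}\<close>.
\<close>

definition knot_step :: "(nat \<Rightarrow> real) \<Rightarrow> nat \<Rightarrow> real" where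
  "knot_step x i = x (i + 1) - x i"

definition affine_a :: "nat \<Rightarrow> (nat \<Rightarrow> real) \<Rightarrow> nat \<Rightarrow> real" where
  "affine_a N x i = (x (i + 1) - x i) / (x N - x 1)"

definition affine_b :: "nat \<Rightarrow> (nat \<Rightarrow> real) \<Rightarrow> nat \<Rightarrow> real" where
  "affine_b N x i = (x N * x i - x 1 * x (i + 1)) / (x N - x 1)"

definition affine_L :: "nat \<Rightarrow> (nat \<Rightarrow> real) \<Rightarrow> nat \<Rightarrow> real \<Rightarrow> real" where
  "affine_L N x i s = affine_a N x i * s + affine_b N x i"

definition coeff_U ::
  "(nat \<Rightarrow> real) \<Rightarrow> (nat \<Rightarrow> real) \<Rightarrow> (nat \<Rightarrow> real) \<Rightarrow> nat \<Rightarrow> real" where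
  "coeff_U y \<alpha> u i = u i * (y i - \<alpha> i * y 1)"

definition coeff_Z ::
  "nat \<Rightarrow> (nat \<Rightarrow> real) \<Rightarrow> (nat \<Rightarrow> real) \<Rightarrow> (nat \<Rightarrow> real) \<Rightarrow> nat \<Rightarrow> real" where
  "coeff_Z N y \<alpha> u i = u i * (y (i + 1) - \<alpha> i * y N)"

definition coeff_V ::
  "nat \<Rightarrow> (nat \<Rightarrow> real) \<Rightarrow> (nat \<Rightarrow> real) \<Rightarrow> (nat \<Rightarrow> real) \<Rightarrow>
   (nat \<Rightarrow> real) \<Rightarrow> (nat \<Rightarrow> real) \<Rightarrow> (nat \<Rightarrow> real) \<Rightarrow> nat \<Rightarrow> real" where
  "coeff_V N x y d \<alpha> u v i =
     (3 * u i + v i) * (y i - \<alpha> i * y 1) + u i * knot_step x i * d i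
       - \<alpha> i * u i * (x N - x 1) * d 1"

definition coeff_W ::
  "nat \<Rightarrow> (nat \<Rightarrow> real) \<Rightarrow> (nat \<Rightarrow> real) \<Rightarrow> (nat \<Rightarrow> real) \<Rightarrow>
   (nat \<Rightarrow> real) \<Rightarrow> (nat \<Rightarrow> real) \<Rightarrow> (nat \<Rightarrow> real) \<Rightarrow> nat \<Rightarrow> real" where
  "coeff_W N x y d \<alpha> u v i =
     (3 * u i + v i) * (y (i + 1) - \<alpha> i * y N) - u i * knot_step x i * d (i + 1)
       + \<alpha> i * u i * (x N - x 1) * d N"

definition P_star ::
  "nat \<Rightarrow> (nat \<Rightarrow> real) \<Rightarrow> (nat \<Rightarrow> real) \<Rightarrow> (nat \<Rightarrow> real) \<Rightarrow>
   (nat \<Rightarrow> real) \<Rightarrow> (nat \<Rightarrow> real) \<Rightarrow> (nat \<Rightarrow> real) \<Rightarrow> nat \<Rightarrow> real \<Rightarrow> real" where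
  "P_star N x y d \<alpha> u v i \<theta> =
     coeff_U y \<alpha> u i * (1 - \<theta>) ^ 3
     + coeff_V N x y d \<alpha> u v i * (1 - \<theta>) ^ 2 * \<theta>
     + coeff_W N x y d \<alpha> u v i * (1 - \<theta>) * \<theta> ^ 2
     + coeff_Z N y \<alpha> u i * \<theta> ^ 3"

definition Q_star :: "(nat \<Rightarrow> real) \<Rightarrow> (nat \<Rightarrow> real) \<Rightarrow> nat \<Rightarrow> real \<Rightarrow> real" where
  "Q_star u v i \<theta> = u i + v i * \<theta> * (1 - \<theta>)"

text \<open>
  The defining property of the rational cubic spline fractal interpolation function. It constrains
  \<open>\<Psi>\<close> on the interval \<open>{x 1..x N}\<close> only; there it determines \<open>\<Psi>\<close> uniquely whenever the knots are
  strictly increasing, \<open>\<bar>\<alpha> i\<bar> < affine_a N x i\<close>, \<open>0 < u i\<close> and \<open>0 \<le> v i\<close>.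
\<close>

definition is_RCSFIF ::
  "nat \<Rightarrow> (nat \<Rightarrow> real) \<Rightarrow> (nat \<Rightarrow> real) \<Rightarrow> (nat \<Rightarrow> real) \<Rightarrow>
   (nat \<Rightarrow> real) \<Rightarrow> (nat \<Rightarrow> real) \<Rightarrow> (nat \<Rightarrow> real) \<Rightarrow> (real \<Rightarrow> real) \<Rightarrow> bool" where
  "is_RCSFIF N x y d \<alpha> u v \<Psi> \<longleftrightarrow>
     continuous_on {x 1..x N} \<Psi> \<and> \<Psi> (x 1) = y 1 \<and> \<Psi> (x N) = y N \<and>
     (\<forall>s\<in>{x 1..x N}. \<forall>i\<in>{1..N - 1}.
        \<Psi> (affine_L N x i s) =
          \<alpha> i * \<Psi> s
          + P_star N x y d \<alpha> u v i ((s - x 1) / (x N - x 1))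
            / Q_star u v i ((s - x 1) / (x N - x 1)))"

text \<open>
  The two lower bounds for \<open>v i\<close>; the argument \<open>t\<close> is the sequence of values of the line at the
  knots.
\<close>

definition bound_v9 ::
  "nat \<Rightarrow> (nat \<Rightarrow> real) \<Rightarrow> (nat \<Rightarrow> real) \<Rightarrow> (nat \<Rightarrow> real) \<Rightarrow>
   (nat \<Rightarrow> real) \<Rightarrow> (nat \<Rightarrow> real) \<Rightarrow> (nat \<Rightarrow> real) \<Rightarrow> nat \<Rightarrow> real" where
  "bound_v9 N x y d t \<alpha> u i =
     - u i *
       ((2 * (y i - t i) + (y i - t (i + 1)) + knot_step x i * d i
          - \<alpha> i * (2 * (y 1 - t 1) + (y 1 - t N) + (x N - x 1) * d 1))
        / (y i - t i - \<alpha> i * (y 1 - t 1)))"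

definition bound_v10 ::
  "nat \<Rightarrow> (nat \<Rightarrow> real) \<Rightarrow> (nat \<Rightarrow> real) \<Rightarrow> (nat \<Rightarrow> real) \<Rightarrow>
   (nat \<Rightarrow> real) \<Rightarrow> (nat \<Rightarrow> real) \<Rightarrow> (nat \<Rightarrow> real) \<Rightarrow> nat \<Rightarrow> real" where
  "bound_v10 N x y d t \<alpha> u i =
     - u i *
       (((y (i + 1) - t i) + 2 * (y (i + 1) - t (i + 1)) - knot_step x i * d (i + 1)
          - \<alpha> i * ((y N - t 1) + 2 * (y N - t N) - (x N - x 1) * d N))
        / (y (i + 1) - t (i + 1) - \<alpha> i * (y N - t N)))"

end

theory Submission
  imports Defs
begin

text \<open>
  The gap \<open>g s = \<Psi> s - (m * s + k)\<close> satisfies \<open>g (L\<^sub>i s) = \<alpha> i * g s + r s\<close>, where \<open>r\<close> is a cubic in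
  Bernstein form divided by \<open>Q_star\<close>; the bounds on \<open>\<alpha>\<close> and \<open>v\<close> make its four coefficients
  positive. Hence \<open>g (L\<^sub>i s) > \<alpha> i * g s\<close>, and at a point \<open>L\<^sub>i s\<close> where the continuous function \<open>g\<close>
  attains its minimum this gives \<open>g (L\<^sub>i s) > \<alpha> i * g (L\<^sub>i s)\<close>, so the minimum is positive because
  \<open>\<alpha> i < 1\<close>.
\<close>

text \<open>Induction on the number of subintervals: either \<open>s\<close> lies at or below the
  second-to-last knot and an earlier subinterval catches it, or the last one does.\<close>

lemma ex_subinterval:
  fixes x :: "nat \<Rightarrow> 'a::linorder"
  assumes "1 < N" "x 1 \<le> s" "s \<le> x N"
  shows "\<exists>i\<in>{1..N - 1}. x i \<le> s \<and> s \<le> x (i + 1)"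
proof -
  have "n \<ge> 1 \<Longrightarrow> s \<le> x (n + 1) \<Longrightarrow> \<exists>i\<in>{1..n}. x i \<le> s \<and> s \<le> x (i + 1)" for n
  proof (induction n)
    case (Suc n)
    show ?case
    proof (cases "n \<ge> 1 \<and> s \<le> x (n + 1)")
      case True
      with Suc.IH show ?thesis by force
    next
      case False
      \<comment> \<open>For \<open>n = 0\<close> the knot \<open>x (Suc n)\<close> is
        \<open>x 1\<close>, so the lower bound on \<open>s\<close> itself applies.\<close>
      then have "x (Suc n) \<le> s"
        using assms(2) by (cases "n = 0") auto
      with Suc.prems show ?thesis by force
    qed
  qed simp
  from this[of "N - 1"] assms show ?thesis by simp
qed

text \<open>In the coordinate \<theta> of \<open>P_star\<close> and \<open>Q_star\<close>, this
  turns the line along the image into an interpolation between its two knot values.\<close>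

lemma affine_L_convex_combination:
  assumes "x 1 \<noteq> x N"
  shows "affine_L N x i (x 1 + \<theta> * (x N - x 1)) = x i * (1 - \<theta>) + x (i + 1) * \<theta>"
proof -
  have "affine_L N x i (x 1 + \<theta> * (x N - x 1))
    = ((x (i + 1) - x i) * (x 1 + \<theta> * (x N - x 1)) + (x N * x i - x 1 * x (i + 1))) / (x N - x 1)"
    by (simp add: affine_L_def affine_a_def affine_b_def add_divide_distrib)
  also have "(x (i + 1) - x i) * (x 1 + \<theta> * (x N - x 1)) + (x N * x i - x 1 * x (i + 1))
    = (x i * (1 - \<theta>) + x (i + 1) * \<theta>) * (x N - x 1)"
    by algebra
  finally show ?thesis using assms by simp
qed

text \<open>The preimage is the point with the same relative position \<theta> in the whole
  interval.\<close>

lemma affine_L_onto: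
  assumes "x 1 < x N" "x i < x (i + 1)" "x i \<le> s" "s \<le> x (i + 1)"
  obtains r where "r \<in> {x 1..x N}" "affine_L N x i r = s"
proof
  define \<theta> where "\<theta> = (s - x i) / (x (i + 1) - x i)"
  have \<theta>: "0 \<le> \<theta>" "\<theta> \<le> 1" and s: "s = x i + \<theta> * (x (i + 1) - x i)"
    using assms by (auto simp: \<theta>_def field_simps)
  have "0 \<le> \<theta> * (x N - x 1)" "\<theta> * (x N - x 1) \<le> x N - x 1"
    using \<theta> assms(1) by (simp_all add: mult_left_le_one_le)
  then show "x 1 + \<theta> * (x N - x 1) \<in> {x 1..x N}"
    unfolding atLeastAtMost_iff by linarith
  show "affine_L N x i (x 1 + \<theta> * (x N - x 1)) = s"
    using assms(1) by (subst affine_L_convex_combination) (simp_all add: s algebra_simps)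
qed

text \<open>The first term is strictly positive unless \<theta> = 1, where only \<open>D\<close>
  survives.\<close>

lemma bernstein_cubic_pos:
  fixes \<theta> :: real
  assumes "0 \<le> \<theta>" "\<theta> \<le> 1" "A > 0" "B \<ge> 0" "C \<ge> 0" "D > 0"
  shows "A * (1 - \<theta>) ^ 3 + B * (1 - \<theta>) ^ 2 * \<theta> + C * (1 - \<theta>) * \<theta> ^ 2 + D * \<theta> ^ 3 > 0"
proof (cases "\<theta> = 1")
  case False
  then have "A * (1 - \<theta>) ^ 3 > 0" using assms by simp
  moreover have "B * (1 - \<theta>) ^ 2 * \<theta> \<ge> 0" "C * (1 - \<theta>) * \<theta> ^ 2 \<ge> 0" "D * \<theta> ^ 3 \<ge> 0"
    using assms by simp_all
  ultimately show ?thesis by linarith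
qed (use assms in simp)

lemma Q_star_pos:
  assumes "u i > 0" "v i \<ge> 0" "0 \<le> \<theta>" "\<theta> \<le> 1"
  shows "Q_star u v i \<theta> > 0"
  using assms by (simp add: Q_star_def add_pos_nonneg)

text \<open>
  The gap between the line and its image under the \<open>i\<close>-th map is affine in \<open>\<theta>\<close>. It is multiplied by
  \<open>Q_star = u i * (1 - \<theta>)\<^sup>2 + (2 * u i + v i) * \<theta> * (1 - \<theta>) + u i * \<theta>\<^sup>2\<close> and absorbed into
  \<open>P_star\<close>; the middle coefficients are \<open>\<ge> 0\<close> by the choice of the bounds.
\<close>
lemma P_star_above_line:
  fixes \<theta> :: real
  assumes u: "u i > 0" and \<theta>: "0 \<le> \<theta>" "\<theta> \<le> 1"
    and left: "y i - t i - \<alpha> i * (y 1 - t 1) > 0"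
    and right: "y (i + 1) - t (i + 1) - \<alpha> i * (y N - t N) > 0"
    and v9: "v i \<ge> bound_v9 N x y d t \<alpha> u i"
    and v10: "v i \<ge> bound_v10 N x y d t \<alpha> u i"
  shows "P_star N x y d \<alpha> u v i \<theta>
    > ((t i - \<alpha> i * t 1) * (1 - \<theta>) + (t (i + 1) - \<alpha> i * t N) * \<theta>) * Q_star u v i \<theta>"
proof -
  \<comment> \<open>\<open>D\<close> and \<open>E\<close> are the denominators of the two bounds,
    \<open>n9\<close> and \<open>n10\<close> the numerators; clearing the positive denominators
    yields the middle Bernstein coefficients.\<close>
  define D where "D = y i - t i - \<alpha> i * (y 1 - t 1)"
  define E where "E = y (i + 1) - t (i + 1) - \<alpha> i * (y N - t N)"
  define n9 where "n9 = 2 * (y i - t i) + (y i - t (i + 1)) + knot_step x i * d i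
          - \<alpha> i * (2 * (y 1 - t 1) + (y 1 - t N) + (x N - x 1) * d 1)"
  define n10 where "n10 = (y (i + 1) - t i) + 2 * (y (i + 1) - t (i + 1))
          - knot_step x i * d (i + 1)
          - \<alpha> i * ((y N - t 1) + 2 * (y N - t N) - (x N - x 1) * d N)"
  have D: "D > 0" and E: "E > 0" using left right by (simp_all add: D_def E_def)
  have "- (u i * n9) / D \<le> v i"
    using v9 by (simp add: bound_v9_def n9_def D_def)
  then have B: "v i * D + u i * n9 \<ge> 0"
    using D by (simp only: pos_divide_le_eq)
  have "- (u i * n10) / E \<le> v i"
    using v10 by (simp add: bound_v10_def n10_def E_def)
  then have C: "v i * E + u i * n10 \<ge> 0"
    using E by (simp only: pos_divide_le_eq)
  have "P_star N x y d \<alpha> u v i \<theta>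
      - ((t i - \<alpha> i * t 1) * (1 - \<theta>) + (t (i + 1) - \<alpha> i * t N) * \<theta>) * Q_star u v i \<theta>
    = u i * D * (1 - \<theta>) ^ 3 + (v i * D + u i * n9) * (1 - \<theta>) ^ 2 * \<theta>
      + (v i * E + u i * n10) * (1 - \<theta>) * \<theta> ^ 2 + u i * E * \<theta> ^ 3"
    unfolding P_star_def Q_star_def coeff_U_def coeff_V_def coeff_W_def coeff_Z_def
      D_def E_def n9_def n10_def
    by algebra
  also have "\<dots> > 0"
    using \<theta> u D E B C by (intro bernstein_cubic_pos) simp_all
  finally show ?thesis by simp
qed

theorem theorem3:
  fixes N :: nat
    and x y d t \<alpha> u v :: "nat \<Rightarrow> real"
    and m k :: real
    and \<Psi> :: "real \<Rightarrow> real"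
  assumes N: "N > 2"
    and knots: "strict_mono_on {1..N} x"
    and line: "\<And>i. i \<in> {1..N} \<Longrightarrow> t i = m * x i + k"
    and above: "\<And>i. i \<in> {1..N} \<Longrightarrow> y i > t i"
    and RCSFIF: "is_RCSFIF N x y d \<alpha> u v \<Psi>"
    and scaling: "\<And>i. i \<in> {1..N - 1} \<Longrightarrow> \<bar>\<alpha> i\<bar> < affine_a N x i"
    and scaling_nonneg: "\<And>i. i \<in> {1..N - 1} \<Longrightarrow> 0 \<le> \<alpha> i"
    and scaling_bound: "\<And>i. i \<in> {1..N - 1} \<Longrightarrow>
           \<alpha> i < min ((y i - t i) / (y 1 - t 1)) ((y (i + 1) - t (i + 1)) / (y N - t N))"
    and shape_u: "\<And>i. i \<in> {1..N - 1} \<Longrightarrow> u i > 0"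
    and shape_v: "\<And>i. i \<in> {1..N - 1} \<Longrightarrow> v i > 0"
    and shape_v_bound: "\<And>i. i \<in> {1..N - 1} \<Longrightarrow>
           v i > Max {0, bound_v9 N x y d t \<alpha> u i, bound_v10 N x y d t \<alpha> u i}"
  shows "\<forall>s\<in>{x 1..x N}. \<Psi> s > m * s + k"
proof -
  have x_less: "x i < x j" if "i < j" "i \<in> {1..N}" "j \<in> {1..N}" for i j
    using knots that by (auto simp: strict_mono_on_def)
  have x1N: "x 1 < x N" using x_less N by simp
  define g where "g s = \<Psi> s - (m * s + k)" for s
  have step: "g (affine_L N x i s) > \<alpha> i * g s"
    if i: "i \<in> {1..N - 1}" and s: "s \<in> {x 1..x N}" for i s
  proof -
    have iN: "i \<in> {1..N}" "i + 1 \<in> {1..N}" "1 \<in> {1..N}" "N \<in> {1..N}"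
      using i N by auto
    define \<theta> where "\<theta> = (s - x 1) / (x N - x 1)"
    have \<theta>: "0 \<le> \<theta>" "\<theta> \<le> 1" using s x1N by (auto simp: \<theta>_def field_simps)
    have s_eq: "s = x 1 + \<theta> * (x N - x 1)" using x1N by (simp add: \<theta>_def)
    have L: "affine_L N x i s = x i * (1 - \<theta>) + x (i + 1) * \<theta>"
      using x1N unfolding s_eq by (intro affine_L_convex_combination) simp
    have pos: "y 1 - t 1 > 0" "y N - t N > 0" using above iN by simp_all
    have left: "y i - t i - \<alpha> i * (y 1 - t 1) > 0"
      and right: "y (i + 1) - t (i + 1) - \<alpha> i * (y N - t N) > 0"
      using scaling_bound[OF i] pos by (simp_all add: pos_less_divide_eq)
    have v: "v i \<ge> bound_v9 N x y d t \<alpha> u i" "v i \<ge> bound_v10 N x y d t \<alpha> u i"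
      using shape_v_bound[OF i] by simp_all
    have Q: "Q_star u v i \<theta> > 0"
      using shape_u[OF i] shape_v[OF i] \<theta> by (intro Q_star_pos) simp_all
    \<comment> \<open>The constants \<open>k\<close> are absorbed into the knot values since the
      weights \<open>1 - \<theta>\<close> and \<theta> sum to 1.\<close>
    have line_gap: "m * affine_L N x i s + k - \<alpha> i * (m * s + k)
        = (t i - \<alpha> i * t 1) * (1 - \<theta>) + (t (i + 1) - \<alpha> i * t N) * \<theta>"
      using line[OF iN(1)] line[OF iN(2)] line[OF iN(3)] line[OF iN(4)]
      unfolding L by (subst s_eq) algebra
    have "\<Psi> (affine_L N x i s)
        = \<alpha> i * \<Psi> s + P_star N x y d \<alpha> u v i \<theta> / Q_star u v i \<theta>"
      using RCSFIF i s unfolding is_RCSFIF_def \<theta>_def by blast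
    moreover have "P_star N x y d \<alpha> u v i \<theta> / Q_star u v i \<theta>
        > m * affine_L N x i s + k - \<alpha> i * (m * s + k)"
      using P_star_above_line[where N = N and x = x and d = d and v = v, of u i \<theta> y t \<alpha>,
          OF shape_u[OF i] \<theta> left right v] Q
      by (simp only: line_gap pos_less_divide_eq)
    ultimately show ?thesis by (simp add: g_def right_diff_distrib)
  qed
  have "continuous_on {x 1..x N} g"
    using RCSFIF unfolding is_RCSFIF_def g_def by (intro continuous_intros) simp
  then obtain s0 where s0: "s0 \<in> {x 1..x N}" and least: "\<And>s. s \<in> {x 1..x N} \<Longrightarrow> g s0 \<le> g s"
    using continuous_attains_inf[of "{x 1..x N}" g] x1N by auto
  obtain i where i: "i \<in> {1..N - 1}" and s0_in: "x i \<le> s0" "s0 \<le> x (i + 1)"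
    using ex_subinterval[of N x s0] N s0 by auto
  have "x i < x (i + 1)" using x_less i by auto
  then obtain r where r: "r \<in> {x 1..x N}" and Lr: "affine_L N x i r = s0"
    using affine_L_onto x1N s0_in by blast
  \<comment> \<open>The end subintervals are split off because \<open>x_less\<close> compares
    distinct indices only.\<close>
  have "x 1 \<le> x i" "x (i + 1) \<le> x N"
    using i x_less[of 1 i] x_less[of "i + 1" N] by (cases "i = 1"; cases "i + 1 = N"; force)+
  then have "affine_a N x i \<le> 1"
    using x1N by (simp add: affine_a_def)
  then have "\<alpha> i < 1" using scaling[OF i] by linarith
  \<comment> \<open>The chain is \<open>g s0 = g (L\<^sub>i r) > \<alpha> i * g r \<ge> \<alpha> i *
    g s0\<close>.\<close>
  moreover have "\<alpha> i * g s0 \<le> \<alpha> i * g r"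
    using least[OF r] scaling_nonneg[OF i] by (rule mult_left_mono)
  then have "(1 - \<alpha> i) * g s0 > 0"
    using step[OF i r] Lr by (simp add: left_diff_distrib)
  ultimately have "g s0 > 0" by (simp add: zero_less_mult_iff)
  then show ?thesis using least by (fastforce simp: g_def)
qed

end
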